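(* For any $\mathcal{F}\subseteq\mathcal{X}^{\mathcal{X}}$, $$\max\left\{\frac{\operatorname{L}(\mathcal{F})}{18},\ \frac{\sqrt{T}}{16\sqrt{3}}\right\}\;\le\;\inf_{\mathcal{A}}\operatorname{MR}_{\mathcal{A}}(T,\mathcal{F})\;\le\;\operatorname{L}(\mathcal{F})+\sqrt{T\,\operatorname{L}(\mathcal{F})\log T},$$ where the infimum is over all (possibly randomized) learners.
   Context: $\mathcal{X}$ is a non-empty set (the state space), $\mathcal{F}\subseteq\mathcal{X}^{\mathcal{X}}$ is a class of functions, $T\in\mathbb{N}$ is the time horizon, and $[d]=\{1,\dots,d\}$. A learner $\mathcal{A}$ is a (possibly randomized) rule that maps every finite sequence of states $x_{<t} := (x_0,\dots,x_{t-1})$ to a prediction $\mathcal{A}(x_{<t}) \in \mathcal{X}$. Expected Markovian regret: $$\operatorname{MR}_{\mathcal{A}}(T,\mathcal{F}) := \sup_{(x_0,x_1,\dots,x_T)}\Big(\mathbb{E}\Big[\sum_{t=1}^T\mathbf{1}\{\mathcal{A}(x_{<t})\ne x_t\}\Big]-\inf_{f\in\mathcal{F}}\sum_{t=1}^T\mathbf{1}\{f(x_{t-1})\ne x_t\}\Big),$$ with the supremum over sequences of states in $\mathcal{X}$ and the expectation over the learner's randomness. Littlestone dimension. For $\sigma\in\{-1,1\}^d$, write $\sigma_{\le t}=(\sigma_1,\dots,\sigma_t)$ and $\sigma_{<t}=(\sigma_1,\dots,\sigma_{t-1})$. Consider a complete binary tree of depth $d$ whose internal nodes are labeled by functions $\mathcal{T}_{t-1}:\{-1,1\}^{t-1}\to\mathcal{X}$,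 $t\in[d]$. It is shattered by $\mathcal{F}$ if there are edge-labeling functions $Y_t:\{-1,1\}^t\to\mathcal{X}$, $t\in[d]$, such that for every $\sigma\in\{-1,1\}^d$ there is $f_\sigma\in\mathcal{F}$ such that for all $t\in[d]$, $f_\sigma(\mathcal{T}_{t-1}(\sigma_{<t}))=Y_t(\sigma_{\le t})$ and $Y_t((\sigma_{<t},-1))\neq Y_t((\sigma_{<t},+1))$. $\operatorname{L}(\mathcal{F})$ is the maximal depth of a tree shattered by $\mathcal{F}$, and $\operatorname{L}(\mathcal{F})=\infty$ if there are shattered trees of arbitrarily large depth.
   Formalization: F is non-empty; the lower bound √T/(16√3) is stated for F with at least two functions (false for |F|=1), and L(F)/18 for L(F) ≤ T (false e.g. for L(F)=∞), with min{L(F),T}/18 in general; the upper bound is unconditional. *)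

theory Defs
  imports "HOL-Probability.Probability"
begin

text \<open>The state space is the type \<open>'a\<close>.  A randomized learner is a random prediction rule,
  represented by its law: a probability measure on the deterministic rules
  \<open>'a list \<Rightarrow> 'a\<close>.  The state space carries no sigma-algebra, so the sigma-algebra on rules is
  only required to contain the events ``the prediction on \<open>h\<close> is \<open>y\<close>'', which are what the
  expected number of mistakes depends on.\<close>

definition learners :: "('a list \<Rightarrow> 'a) measure set" where
  "learners = {M. prob_space M \<and> space M = UNIV \<and> (\<forall>h y. {A. A h = y} \<in> sets M)}"

definition expected_mistakes ::
    "('a list \<Rightarrow> 'a) measure \<Rightarrow> nat \<Rightarrow> (nat \<Rightarrow> 'a) \<Rightarrow> real" where
  "expected_mistakes M T x =
     (LINT A|M. (\<Sum>t = 1..T. of_bool (A (map x [0..<t]) \<noteq> x t)))"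

definition mistakes :: "('a \<Rightarrow> 'a) \<Rightarrow> nat \<Rightarrow> (nat \<Rightarrow> 'a) \<Rightarrow> real" where
  "mistakes f T x = (\<Sum>t = 1..T. of_bool (f (x (t - 1)) \<noteq> x t))"

text \<open>The supremum ranges over infinite state sequences, but only \<open>x 0, \<dots>, x T\<close> matter.\<close>

definition markov_regret ::
    "('a list \<Rightarrow> 'a) measure \<Rightarrow> nat \<Rightarrow> ('a \<Rightarrow> 'a) set \<Rightarrow> ereal" where
  "markov_regret M T F =
     (SUP x. ereal (expected_mistakes M T x) - (INF f\<in>F. ereal (mistakes f T x)))"

definition minimax_regret :: "nat \<Rightarrow> ('a \<Rightarrow> 'a) set \<Rightarrow> ereal" where
  "minimax_regret T F = (INF M\<in>learners. markov_regret M T F)"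

text \<open>Sign vectors are lists over \<open>bool\<close>, with \<open>False\<close> for \<open>-1\<close> and \<open>True\<close> for \<open>+1\<close>.
  The level-indexed families of node labels and of edge labels are each merged into one function on
  lists, the length of the list being the level.\<close>

definition shattered_tree :: "('a \<Rightarrow> 'a) set \<Rightarrow> nat \<Rightarrow> (bool list \<Rightarrow> 'a) \<Rightarrow> bool" where
  "shattered_tree F d node \<longleftrightarrow>
     (\<exists>Y :: bool list \<Rightarrow> 'a. \<forall>\<sigma>. length \<sigma> = d \<longrightarrow>
        (\<exists>f\<in>F. \<forall>t\<in>{1..d}.
           f (node (take (t - 1) \<sigma>)) = Y (take t \<sigma>) \<and>
           Y (take (t - 1) \<sigma> @ [False]) \<noteq> Y (take (t - 1) \<sigma> @ [True])))"

definition Ldim :: "('a \<Rightarrow> 'a) set \<Rightarrow> enat" where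
  "Ldim F = (SUP d\<in>{d. \<exists>node. shattered_tree F d node}. enat d)"

text \<open>The value of \<open>L + sqrt (T * L * ln T)\<close>, which is infinite if \<open>L\<close> is.\<close>

definition upper_bound :: "enat \<Rightarrow> nat \<Rightarrow> ereal" where
  "upper_bound L T =
     (case L of
        enat l \<Rightarrow> ereal (real l + sqrt (real T * real l * ln (real T)))
      | \<infinity> \<Rightarrow> \<infinity>)"

end

theory Submission
  imports Defs
begin

text \<open>Lower bounds: at most one of several candidate next states can be predicted well, so an
  adversary that picks the next state at random from \<open>k\<close> candidates forces a mistake with probability
  at least \<open>1 - 1 / k\<close>.  Jumping to one of three nodes of a shattered tree and then revealing the label
  of that node costs the learner \<open>2 / 3 + 1 / 2\<close> mistakes and a consistent comparator at most one.
  For the horizon bound, a random walk driven by two distinct functions is as hard for the learner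
  as for the average of the two, and the better one gains from the fluctuations.  Both adversaries
  are derandomized step by step.

  Upper bound: exponential weights over experts that run the standard optimal algorithm but update
  it only at a prescribed set of at most \<open>L\<close> times.  Updating only at the times where the best
  comparator is right and the algorithm is wrong makes the number of experts independent of
  the number of states.\<close>

section \<open>Shattered trees\<close>

abbreviation restrict_fns :: "('a \<Rightarrow> 'b) set \<Rightarrow> 'a \<Rightarrow> 'b \<Rightarrow> ('a \<Rightarrow> 'b) set" where
  "restrict_fns F x y \<equiv> {f \<in> F. f x = y}"

text \<open>Both the adversary and the standard optimal algorithm descend by restricting the class
  to one label at one point, so this recursion at the root replaces labelled trees from here
  on.\<close>

primrec shatters :: "('a \<Rightarrow> 'b) set \<Rightarrow> nat \<Rightarrow> bool" where
  "shatters F 0 \<longleftrightarrow> F \<noteq> {}"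
| "shatters F (Suc d) \<longleftrightarrow>
     (\<exists>x y z. y \<noteq> z \<and> shatters (restrict_fns F x y) d \<and> shatters (restrict_fns F x z) d)"

lemma shatters_mono: "shatters F d \<Longrightarrow> F \<subseteq> G \<Longrightarrow> shatters G d"
proof (induction d arbitrary: F G)
  case (Suc d)
  have "restrict_fns F x y \<subseteq> restrict_fns G x y" for x y
    using Suc.prems by auto
  then show ?case
    using Suc.prems Suc.IH by simp meson
qed auto

lemma shatters_Suc_imp: "shatters F (Suc d) \<Longrightarrow> shatters F d"
proof -
  assume "shatters F (Suc d)"
  then obtain x y where "shatters (restrict_fns F x y) d"
    by auto
  then show "shatters F d"
    by (rule shatters_mono) auto
qed

lemma shatters_antimono: "shatters F d \<Longrightarrow> e \<le> d \<Longrightarrow> shatters F e"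
  by (rule inc_induct[of e d "shatters F"]) (auto simp del: shatters.simps dest: shatters_Suc_imp)

definition tree_labels ::
    "('a \<Rightarrow> 'a) set \<Rightarrow> nat \<Rightarrow> (bool list \<Rightarrow> 'a) \<Rightarrow> (bool list \<Rightarrow> 'a) \<Rightarrow> bool" where
  "tree_labels F d node Y \<longleftrightarrow>
     (\<forall>\<sigma>. length \<sigma> = d \<longrightarrow> (\<exists>f\<in>F. \<forall>t<d.
        f (node (take t \<sigma>)) = Y (take (Suc t) \<sigma>) \<and>
        Y (take t \<sigma> @ [False]) \<noteq> Y (take t \<sigma> @ [True])))"

lemma shattered_tree_iff: "shattered_tree F d node \<longleftrightarrow> (\<exists>Y. tree_labels F d node Y)"
proof -
  have *: "(\<forall>t\<in>{1..d}. P (t - 1) t) \<longleftrightarrow> (\<forall>t<d. P t (Suc t))" for P :: "nat \<Rightarrow> nat \<Rightarrow> bool"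
  proof safe
    fix t assume "\<forall>t\<in>{1..d}. P (t - 1) t" "t < d"
    then show "P t (Suc t)"
      by (auto dest!: bspec[of _ _ "Suc t"])
  next
    fix t assume "\<forall>t<d. P t (Suc t)" "t \<in> {1..d}"
    then show "P (t - 1) t"
      by (cases t) auto
  qed
  show ?thesis
    unfolding shattered_tree_def tree_labels_def
    by (subst *[of "\<lambda>s t. _ (node (take s _)) = _ (take t _) \<and> _ (take s _ @ _) \<noteq> _ (take s _ @ _)"])
       (rule refl)
qed

text \<open>Every branch through the child \<open>b\<close> is realized by a function with value
  \<open>Y [b]\<close> at the root, so the subtree below \<open>b\<close> is shattered by that
  restriction.\<close>

lemma tree_labels_imp_shatters: "tree_labels F d node Y \<Longrightarrow> shatters F d"
proof (induction d arbitrary: F node Y)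
  case 0
  then show ?case
    by (auto simp: tree_labels_def)
next
  case (Suc d)
  have "shatters (restrict_fns F (node []) (Y [b])) d" for b
  proof (rule Suc.IH)
    show "tree_labels (restrict_fns F (node []) (Y [b])) d (\<lambda>\<sigma>. node (b # \<sigma>)) (\<lambda>\<sigma>. Y (b # \<sigma>))"
      unfolding tree_labels_def
    proof (intro allI impI)
      fix \<sigma> :: "bool list" assume "length \<sigma> = d"
      then obtain f where f: "f \<in> F" and
        ft: "\<And>t. t < Suc d \<Longrightarrow> f (node (take t (b # \<sigma>))) = Y (take (Suc t) (b # \<sigma>)) \<and>
          Y (take t (b # \<sigma>) @ [False]) \<noteq> Y (take t (b # \<sigma>) @ [True])"
        using Suc.prems unfolding tree_labels_def by (metis length_Cons)
      show "\<exists>f\<in>restrict_fns F (node []) (Y [b]). \<forall>t<d.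
          f (node (b # take t \<sigma>)) = Y (b # take (Suc t) \<sigma>) \<and>
          Y (b # take t \<sigma> @ [False]) \<noteq> Y (b # take t \<sigma> @ [True])"
      proof (rule bexI[of _ f], intro allI impI)
        fix t assume "t < d"
        then show "f (node (b # take t \<sigma>)) = Y (b # take (Suc t) \<sigma>) \<and>
          Y (b # take t \<sigma> @ [False]) \<noteq> Y (b # take t \<sigma> @ [True])"
          using ft[of "Suc t"] by simp
      qed (use f ft[of 0] in auto)
    qed
  qed
  moreover have "Y [False] \<noteq> Y [True]"
    using Suc.prems unfolding tree_labels_def
    by (metis append_Nil length_replicate take_0 zero_less_Suc)
  ultimately show ?case
    by auto
qed

lemma shatters_imp_tree_labels: "shatters F d \<Longrightarrow> \<exists>node Y. tree_labels F d node Y"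
proof (induction d arbitrary: F)
  case 0
  then show ?case
    by (auto simp: tree_labels_def)
next
  case (Suc d)
  then obtain x y0 y1 where ne: "y0 \<noteq> y1"
    and sh: "shatters (restrict_fns F x y0) d" "shatters (restrict_fns F x y1) d"
    by auto
  define y where "y b = (if b then y1 else y0)" for b
  have "\<forall>b. \<exists>node Y. tree_labels (restrict_fns F x (y b)) d node Y"
    using Suc.IH sh by (auto simp: y_def)
  then obtain node Y where sub: "\<And>b. tree_labels (restrict_fns F x (y b)) d (node b) (Y b)"
    by metis
  define node' where "node' \<sigma> = (case \<sigma> of [] \<Rightarrow> x | b # \<tau> \<Rightarrow> node b \<tau>)" for \<sigma>
  \<comment> \<open>Lists of length one are the edges leaving the new root. The subtrees say nothing
    about these, so they get the labels \<open>y b\<close> of the split.\<close>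
  define Y' where
    "Y' \<sigma> = (case \<sigma> of [] \<Rightarrow> x | b # \<tau> \<Rightarrow> if \<tau> = [] then y b else Y b \<tau>)" for \<sigma>
  have "tree_labels F (Suc d) node' Y'"
    unfolding tree_labels_def
  proof (intro allI impI)
    fix \<sigma> :: "bool list" assume "length \<sigma> = Suc d"
    then obtain b \<tau> where \<sigma>: "\<sigma> = b # \<tau>" and \<tau>: "length \<tau> = d"
      by (cases \<sigma>) auto
    from sub[of b] \<tau> obtain f where f: "f \<in> F" "f x = y b" and
      ft: "\<And>t. t < d \<Longrightarrow> f (node b (take t \<tau>)) = Y b (take (Suc t) \<tau>) \<and>
        Y b (take t \<tau> @ [False]) \<noteq> Y b (take t \<tau> @ [True])"
      unfolding tree_labels_def by blast
    show "\<exists>f\<in>F. \<forall>t<Suc d. f (node' (take t \<sigma>)) = Y' (take (Suc t) \<sigma>) \<and>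
        Y' (take t \<sigma> @ [False]) \<noteq> Y' (take t \<sigma> @ [True])"
    proof (rule bexI[OF _ f(1)], intro allI impI)
      fix t assume t: "t < Suc d"
      show "f (node' (take t \<sigma>)) = Y' (take (Suc t) \<sigma>) \<and>
        Y' (take t \<sigma> @ [False]) \<noteq> Y' (take t \<sigma> @ [True])"
      proof (cases t)
        case 0
        then show ?thesis
          using f(2) ne by (simp add: \<sigma> node'_def Y'_def y_def)
      next
        case (Suc s)
        then have "s < d" "take (Suc s) \<tau> \<noteq> []"
          using t \<tau> by auto
        then show ?thesis
          using ft[of s] Suc by (simp add: \<sigma> node'_def Y'_def)
      qed
    qed
  qed
  then show ?case
    by blast
qed

lemma shattered_tree_iff_shatters: "(\<exists>node. shattered_tree F d node) \<longleftrightarrow> shatters F d"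
  using shatters_imp_tree_labels tree_labels_imp_shatters
  unfolding shattered_tree_iff by metis

lemma Ldim_eq: "Ldim F = (SUP d\<in>{d. shatters F d}. enat d)"
  unfolding Ldim_def shattered_tree_iff_shatters ..

lemma shatters_imp_le_Ldim: "shatters F d \<Longrightarrow> enat d \<le> Ldim F"
  unfolding Ldim_eq by (rule SUP_upper) simp

text \<open>Shattered depths are downward closed, so a missing depth bounds all of them and hence
  the supremum. Nonemptiness provides depth 0, which the supremum cannot tell from no depth at
  all.\<close>

lemma le_Ldim_imp_shatters:
  assumes "F \<noteq> {}" "enat d \<le> Ldim F"
  shows "shatters F d"
proof (rule ccontr)
  assume n: "\<not> shatters F d"
  then obtain e where d: "d = Suc e"
    using assms(1) by (cases d) auto
  have "k \<le> e" if "shatters F k" for k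
    using that n d shatters_antimono by (metis not_less_eq_eq)
  then have "Ldim F \<le> enat e"
    unfolding Ldim_eq by (auto intro!: SUP_least)
  with assms(2) d show False
    by (metis Suc_n_not_le_n enat_ord_simps(1) order_trans)
qed

section \<open>Cumulative losses\<close>

primrec cum_loss :: "('a list \<Rightarrow> 'a \<Rightarrow> real) \<Rightarrow> 'a list \<Rightarrow> 'a list \<Rightarrow> real" where
  "cum_loss q h [] = 0"
| "cum_loss q h (y # ys) = q h y + cum_loss q (h @ [y]) ys"

abbreviation fun_loss :: "('a \<Rightarrow> 'a) \<Rightarrow> 'a list \<Rightarrow> 'a \<Rightarrow> real" where
  "fun_loss f h y \<equiv> of_bool (f (last h) \<noteq> y)"

lemma cum_loss_eq_sum:
  "cum_loss q h ys = (\<Sum>t<length ys. q (h @ take t ys) (ys ! t))"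
  by (induction ys arbitrary: h) (simp_all add: sum.lessThan_Suc_shift del: sum.lessThan_Suc)

lemma cum_loss_nonneg: "(\<And>h y. 0 \<le> q h y) \<Longrightarrow> 0 \<le> cum_loss q h ys"
  unfolding cum_loss_eq_sum by (rule sum_nonneg) blast

text \<open>The initial state \<open>a\<close> is given and not predicted; the prediction of state t
  sees the t states before it.\<close>

lemma cum_loss_path:
  assumes "length ys = T"
  shows "(\<Sum>t = 1..T. q (map ((!) (a # ys)) [0..<t]) ((a # ys) ! t)) = cum_loss q [a] ys"
proof -
  have "(\<Sum>t = 1..T. q (map ((!) (a # ys)) [0..<t]) ((a # ys) ! t)) =
      (\<Sum>t<T. q (map ((!) (a # ys)) [0..<Suc t]) ((a # ys) ! Suc t))"
    unfolding One_nat_def by (rule sum.atLeast1_atMost_eq)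
  also have "\<dots> = (\<Sum>t<T. q ([a] @ take t ys) (ys ! t))"
  proof (rule sum.cong[OF refl])
    fix t assume "t \<in> {..<T}"
    then have "map ((!) (a # ys)) [0..<Suc t] = take (Suc t) (a # ys)"
      using assms by (intro nth_equalityI) (auto simp del: upt_Suc take_Suc_Cons)
    then show "q (map ((!) (a # ys)) [0..<Suc t]) ((a # ys) ! Suc t) =
        q ([a] @ take t ys) (ys ! t)"
      by simp
  qed
  finally show ?thesis
    using assms by (simp add: cum_loss_eq_sum)
qed

lemma mistakes_path:
  assumes "length ys = T"
  shows "mistakes f T ((!) (a # ys)) = cum_loss (fun_loss f) [a] ys"
proof -
  have "mistakes f T ((!) (a # ys)) =
      (\<Sum>t = 1..T. fun_loss f (map ((!) (a # ys)) [0..<t]) ((a # ys) ! t))"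
    unfolding mistakes_def by (rule sum.cong[OF refl]) (auto simp: last_map)
  then show ?thesis
    using cum_loss_path[OF assms, of "fun_loss f"] by simp
qed

section \<open>One-step error probabilities of a learner\<close>

definition pred_loss :: "('a list \<Rightarrow> 'a) measure \<Rightarrow> 'a list \<Rightarrow> 'a \<Rightarrow> real" where
  "pred_loss M h y = 1 - measure M {A. A h = y}"

lemma expected_mistakes_eq:
  assumes "M \<in> learners"
  shows "expected_mistakes M T x = (\<Sum>t = 1..T. pred_loss M (map x [0..<t]) (x t))"
proof -
  interpret prob_space M
    using assms by (auto simp: learners_def)
  have sp: "space M = UNIV" and ev: "{A. A h = y} \<in> sets M" for h y
    using assms by (auto simp: learners_def)
  have compl: "{A. A h \<noteq> y} = space M - {A. A h = y}" for h y
    using sp by auto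
  have ev': "{A. A h \<noteq> y} \<in> sets M" for h y
    unfolding compl by (intro sets.compl_sets ev)
  have ind: "(of_bool (A h \<noteq> y) :: real) = indicator {A. A h \<noteq> y} A" for A h y
    by (auto simp: indicator_def)
  have int: "integrable M (indicator {A. A h \<noteq> y} :: _ \<Rightarrow> real)" for h y
    by (rule integrable_real_indicator) (simp_all add: ev' emeasure_eq_measure)
  have "expected_mistakes M T x = (\<Sum>t = 1..T. measure M {A. A (map x [0..<t]) \<noteq> x t})"
    unfolding expected_mistakes_def ind
    by (subst Bochner_Integration.integral_sum) (simp_all add: int sp)
  also have "\<dots> = (\<Sum>t = 1..T. pred_loss M (map x [0..<t]) (x t))"
    unfolding compl pred_loss_def prob_compl[OF ev] ..
  finally show ?thesis .
qed

text \<open>All that the adversaries know about a learner: predictions of different values are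
  disjoint events, so the probabilities \<open>1 - q h y\<close> add up to at most one.\<close>

locale guess_loss =
  fixes q :: "'a list \<Rightarrow> 'a \<Rightarrow> real"
  assumes loss_ge: "0 \<le> q h y"
    and sum_ge: "finite S \<Longrightarrow> real (card S) - 1 \<le> (\<Sum>y\<in>S. q h y)"

lemma guess_loss_pred_loss:
  assumes "M \<in> learners"
  shows "guess_loss (pred_loss M)"
proof
  interpret prob_space M
    using assms by (auto simp: learners_def)
  have ev: "{A. A h = y} \<in> sets M" for h y
    using assms by (auto simp: learners_def)
  show "0 \<le> pred_loss M h y" for h y
    by (simp add: pred_loss_def)
  show "real (card S) - 1 \<le> (\<Sum>y\<in>S. pred_loss M h y)" if "finite S" for S h
  proof -
    have "(\<Sum>y\<in>S. measure M {A. A h = y}) = measure M (\<Union>y\<in>S. {A. A h = y})"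
      using that by (intro finite_measure_finite_Union[symmetric])
        (auto simp: ev disjoint_family_on_def)
    also have "\<dots> \<le> 1"
      by simp
    finally show ?thesis
      by (simp add: pred_loss_def sum_subtractf)
  qed
qed

context guess_loss
begin

lemma ex_ge:
  assumes "finite S" "S \<noteq> {}"
  shows "\<exists>y\<in>S. 1 - 1 / real (card S) \<le> q h y"
proof (rule ccontr)
  assume "\<not> ?thesis"
  then have "(\<Sum>y\<in>S. q h y) < (\<Sum>y\<in>S. 1 - 1 / real (card S))"
    using assms by (intro sum_strict_mono) auto
  also have "\<dots> = real (card S) - 1"
    using assms by (simp add: field_simps)
  finally show False
    using sum_ge[OF assms(1), of h] by simp
qed

lemma pair_ge: "u \<noteq> v \<Longrightarrow> 1 \<le> q h u + q h v"
  using sum_ge[of "{u, v}" h] by simp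

section \<open>The lower bound in terms of the Littlestone dimension\<close>

text \<open>Fills the steps left over when the tree is used up: the comparator pays nothing there,
  and the learner's loss is nonnegative.\<close>

lemma follow:
  assumes "h \<noteq> []"
  shows "\<exists>ys. length ys = r \<and> cum_loss (fun_loss f) h ys = 0"
  using assms
proof (induction r arbitrary: h)
  case (Suc r)
  from Suc.IH[of "h @ [f (last h)]"] obtain ys where
    "length ys = r" "cum_loss (fun_loss f) (h @ [f (last h)]) ys = 0"
    by auto
  then show ?case
    by (intro exI[of _ "f (last h) # ys"]) simp
qed simp

text \<open>Each round spends three levels of the tree and two steps.  The three levels provide three
  distinct nodes to jump to; some jump is missed with probability at least \<open>2/3\<close>, at the cost of at
  most one mistake of the comparator, and then the label of that node is missed with probability at
  least \<open>1/2\<close>.\<close>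

lemma tree_rounds:
  assumes "h \<noteq> []" "shatters F (3 * m)" "2 * m \<le> r"
  shows "\<exists>ys. length ys = r \<and>
    (\<exists>f\<in>F. real m / 6 \<le> cum_loss q h ys - cum_loss (fun_loss f) h ys)"
  using assms
proof (induction m arbitrary: h F r)
  case 0
  then obtain f where "f \<in> F"
    by auto
  moreover obtain ys where "length ys = r" "cum_loss (fun_loss f) h ys = 0"
    using follow 0 by metis
  ultimately show ?case
    using cum_loss_nonneg[of q h ys] loss_ge by force
next
  case (Suc m)
  define k where "k = 3 * m"
  have "shatters F (Suc (Suc (Suc k)))"
    using Suc.prems(2) by (simp add: k_def numeral_3_eq_3)
  then obtain x1 y1 z1 where t1: "y1 \<noteq> z1" "shatters (restrict_fns F x1 y1) (Suc (Suc k))"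
      "shatters (restrict_fns F x1 z1) (Suc (Suc k))"
    unfolding shatters.simps(2)[of F] by blast
  define F1 where "F1 = restrict_fns F x1 y1"
  obtain x2 y2 z2 where t2: "y2 \<noteq> z2" "shatters (restrict_fns F1 x2 y2) (Suc k)"
      "shatters (restrict_fns F1 x2 z2) (Suc k)"
    using t1(2) unfolding F1_def[symmetric] shatters.simps(2)[of F1] by blast
  define F2 where "F2 = restrict_fns F1 x2 y2"
  obtain x3 y3 z3 where t3: "y3 \<noteq> z3" "shatters (restrict_fns F2 x3 y3) k"
      "shatters (restrict_fns F2 x3 z3) k"
    using t2(2) unfolding F2_def[symmetric] shatters.simps(2)[of F2] by blast
  have sub: "F1 \<subseteq> F" "F2 \<subseteq> F1" "F2 \<subseteq> F"
    by (auto simp: F1_def F2_def)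
  \<comment> \<open>All of \<open>G\<close> agrees at \<open>x\<close> but takes two values at
    \<open>x'\<close>. Hence descending along fixed labels produces new points.\<close>
  have distinct: "x \<noteq> x'"
    if ne: "y' \<noteq> z'" and y': "shatters (restrict_fns G x' y') n"
      and z': "shatters (restrict_fns G x' z') n" and G: "\<And>f. f \<in> G \<Longrightarrow> f x = y" for x x' y y' z' G n
  proof -
    have "restrict_fns G x' y' \<noteq> {}" "restrict_fns G x' z' \<noteq> {}"
      using shatters_antimono[OF y' le0] shatters_antimono[OF z' le0] by simp_all
    then obtain f g where fg: "f \<in> G" "f x' = y'" "g \<in> G" "g x' = z'"
      by blast
    show ?thesis
      using ne fg G[OF fg(1)] G[OF fg(3)] by metis
  qed
  have "x1 \<noteq> x2"
    by (rule distinct[OF t2, of x1 y1]) (simp add: F1_def)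
  moreover have "x1 \<noteq> x3"
    by (rule distinct[OF t3, of x1 y1]) (simp add: F1_def F2_def)
  moreover have "x2 \<noteq> x3"
    by (rule distinct[OF t3, of x2 y2]) (simp add: F2_def)
  ultimately have card: "card {x1, x2, x3} = 3"
    by simp
  \<comment> \<open>The restrictions that served to find \<open>x2\<close> and \<open>x3\<close> are
    undone by monotonicity, so each of the three points still splits the whole class.\<close>
  have node: "\<exists>y z. y \<noteq> z \<and> shatters (restrict_fns F x y) k \<and> shatters (restrict_fns F x z) k"
    if "x \<in> {x1, x2, x3}" for x
  proof -
    have low: "\<exists>y z. y \<noteq> z \<and> shatters (restrict_fns F x y) k \<and> shatters (restrict_fns F x z) k"
      if ne: "y \<noteq> z" and y: "shatters (restrict_fns G x y) n"
        and z: "shatters (restrict_fns G x z) n" and G: "G \<subseteq> F" "k \<le> n" for G x y z n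
    proof -
      have sub': "restrict_fns G x w \<subseteq> restrict_fns F x w" for w
        using G(1) by auto
      have "shatters (restrict_fns F x y) k" "shatters (restrict_fns F x z) k"
        by (rule shatters_antimono[OF shatters_mono[OF y sub'] G(2)]
            shatters_antimono[OF shatters_mono[OF z sub'] G(2)])+
      with ne show ?thesis
        by (intro exI[of _ y] exI[of _ z]) simp
    qed
    show ?thesis
      using that low[OF t1] low[OF t2 sub(1)] low[OF t3 sub(3)]
      by (elim insertE emptyE) simp_all
  qed
  obtain x where x: "x \<in> {x1, x2, x3}" "2 / 3 \<le> q h x"
    using ex_ge[of "{x1, x2, x3}" h] card by auto
  obtain y z where "y \<noteq> z" "shatters (restrict_fns F x y) k" "shatters (restrict_fns F x z) k"
    using node[OF x(1)] by blast
  then obtain w where w: "shatters (restrict_fns F x w) k" "1 / 2 \<le> q (h @ [x]) w"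
    using pair_ge[of y z "h @ [x]"] by (cases "1 / 2 \<le> q (h @ [x]) y") auto
  have "2 * m \<le> r - 2"
    using Suc.prems by simp
  from Suc.IH[OF _ w(1)[unfolded k_def] this, of "h @ [x, w]"]
  obtain ys f where ys: "length ys = r - 2" "f \<in> F" "f x = w"
      "real m / 6 \<le> cum_loss q (h @ [x, w]) ys - cum_loss (fun_loss f) (h @ [x, w]) ys"
    by auto
  show ?case
  proof (intro exI[of _ "x # w # ys"] conjI bexI[of _ f])
    show "length (x # w # ys) = r"
      using Suc.prems ys by simp
    \<comment> \<open>The learner loses 2/3 + 1/2, the comparator at most 1 on the jump and 0 on
      \<open>w\<close> because \<open>f x = w\<close>; this leaves 1/6 per three levels.\<close>
    show "real (Suc m) / 6 \<le>
        cum_loss q h (x # w # ys) - cum_loss (fun_loss f) h (x # w # ys)"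
      using ys(3,4) x(2) w(2) by (simp add: field_simps)
  qed (use ys in auto)
qed

text \<open>Starting at the root costs the comparator nothing, and revealing its label gains 1/2.
  That exceeds the 3/18 owed for the root and the at most two levels that rounds of three leave
  over.\<close>

lemma regret_ge_dim:
  assumes "shatters F d" "d \<le> T"
  shows "\<exists>a ys. length ys = T \<and>
    (\<exists>f\<in>F. real d / 18 \<le> cum_loss q [a] ys - cum_loss (fun_loss f) [a] ys)"
proof (cases d)
  case 0
  then show ?thesis
    using tree_rounds[of "[undefined]" F 0 T] assms by auto
next
  case (Suc e)
  define m where "m = e div 3"
  obtain a y z where "y \<noteq> z" "shatters (restrict_fns F a y) e" "shatters (restrict_fns F a z) e"
    using assms Suc by auto
  then obtain w where w: "shatters (restrict_fns F a w) e" "1 / 2 \<le> q [a] w"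
    using pair_ge[of y z "[a]"] by (cases "1 / 2 \<le> q [a] y") auto
  have m: "3 * m \<le> e" "2 * m \<le> T - 1" "d \<le> 3 * m + 3"
    using assms(2) Suc by (auto simp: m_def)
  obtain ys f where ys: "length ys = T - 1" "f \<in> F" "f a = w"
      "real m / 6 \<le> cum_loss q [a, w] ys - cum_loss (fun_loss f) [a, w] ys"
    using tree_rounds[OF _ shatters_antimono[OF w(1) m(1)] m(2), of "[a, w]"] by auto
  show ?thesis
  proof (intro exI[of _ a] exI[of _ "w # ys"] conjI bexI[of _ f])
    have "real d \<le> 3 * real m + 3"
      using m(3) by linarith
    then show "real d / 18 \<le> cum_loss q [a] (w # ys) - cum_loss (fun_loss f) [a] (w # ys)"
      using ys(3,4) w(2) by simp
  qed (use ys assms Suc in auto)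
qed

section \<open>The lower bound in terms of the horizon\<close>

text \<open>The adversary follows a random walk with fair coin tosses: where \<open>f\<close> and \<open>g\<close> differ, it moves
  to one of the two values; elsewhere it moves to the common value or to \<open>a\<close>, where they differ.  A
  learner then does no better on average than \<open>f\<close> and \<open>g\<close> on average, and the better of the two
  gains half of \<open>\<bar>S\<bar>\<close>, where \<open>S\<close> is the difference of their losses.  Since at least a third of
  the visited states lie where \<open>f\<close> and \<open>g\<close> differ, the second moment of \<open>S\<close> is at least \<open>T / 3\<close>,
  and its fourth moment is at most \<open>3 T\<^sup>2\<close>.  The potential is a lower bound for the conditional
  expectation of \<open>\<alpha> S\<^sup>2 - \<beta> S\<^sup>4\<close> given \<open>S = s\<close> and \<open>r\<close> remaining steps.\<close>

definition walk_potential :: "real \<Rightarrow> real \<Rightarrow> nat \<Rightarrow> bool \<Rightarrow> real \<Rightarrow> real" where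
  "walk_potential \<alpha> \<beta> r differ s =
     \<alpha> * (s\<^sup>2 + real r / 3 - (if differ then 0 else 2 / 3)) -
     \<beta> * (s ^ 4 + 6 * real r * s\<^sup>2 + 3 * (real r)\<^sup>2)"

text \<open>A step of size one raises the second moment by 1. This pays exactly for the 1/3 of the
  step and the debt of 2/3 incurred if both successors are states of agreement. The fourth moment is
  bounded as for a walk that moves at every step.\<close>

lemma walk_potential_differ:
  assumes "0 \<le> \<alpha>" "0 \<le> \<beta>"
  shows "2 * walk_potential \<alpha> \<beta> (Suc r) True s \<le>
    walk_potential \<alpha> \<beta> r d (s - 1) + walk_potential \<alpha> \<beta> r e (s + 1)"
proof -
  have "walk_potential \<alpha> \<beta> r False s' \<le> walk_potential \<alpha> \<beta> r d s'" for s' d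
    using assms by (auto simp: walk_potential_def intro!: mult_left_mono)
  note this[of "s - 1" d] this[of "s + 1" e]
  moreover have "walk_potential \<alpha> \<beta> r False (s - 1) + walk_potential \<alpha> \<beta> r False (s + 1) -
      2 * walk_potential \<alpha> \<beta> (Suc r) True s = 4 * \<beta>"
    unfolding walk_potential_def by (simp add: algebra_simps power2_eq_square power4_eq_xxxx)
  ultimately show ?thesis
    using assms by linarith
qed

text \<open>With probability 1/2 the walk returns to a state of disagreement, which repays the debt
  of 2/3: on average exactly the 1/3 of the step.\<close>

lemma walk_potential_same:
  assumes "0 \<le> \<alpha>" "0 \<le> \<beta>"
  shows "2 * walk_potential \<alpha> \<beta> (Suc r) False s \<le>
    walk_potential \<alpha> \<beta> r d s + walk_potential \<alpha> \<beta> r True s"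
proof -
  have "walk_potential \<alpha> \<beta> r False s \<le> walk_potential \<alpha> \<beta> r d s"
    using assms by (auto simp: walk_potential_def intro!: mult_left_mono)
  moreover have "walk_potential \<alpha> \<beta> r False s + walk_potential \<alpha> \<beta> r True s -
      2 * walk_potential \<alpha> \<beta> (Suc r) False s = \<beta> * (12 * s\<^sup>2 + 12 * real r + 6)"
    unfolding walk_potential_def by (simp add: algebra_simps power2_eq_square)
  moreover have "0 \<le> \<beta> * (12 * s\<^sup>2 + 12 * real r + 6)"
    using assms by simp
  ultimately show ?thesis
    by linarith
qed

text \<open>The case where the common value is \<open>a\<close> itself: no coin is tossed and the
  whole debt is repaid.\<close>

lemma walk_potential_return:
  assumes "0 \<le> \<alpha>" "0 \<le> \<beta>"
  shows "walk_potential \<alpha> \<beta> (Suc r) False s \<le> walk_potential \<alpha> \<beta> r True s"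
proof -
  have "walk_potential \<alpha> \<beta> r True s - walk_potential \<alpha> \<beta> (Suc r) False s =
      \<alpha> / 3 + \<beta> * (6 * s\<^sup>2 + 6 * real r + 3)"
    unfolding walk_potential_def by (simp add: field_simps power2_eq_square)
  moreover have "0 \<le> \<alpha> / 3 + \<beta> * (6 * s\<^sup>2 + 6 * real r + 3)"
    using assms by simp
  ultimately show ?thesis
    by linarith
qed

text \<open>Over the two candidates the learner's losses add up to at least 1, and the averages of
  the losses of \<open>f\<close> and \<open>g\<close> to exactly 1. So one candidate does at least
  as well as the coin, and the walk takes it.\<close>

lemma walk_value:
  fixes f g :: "'a \<Rightarrow> 'a"
  assumes fg: "f a \<noteq> g a" and nonneg: "0 \<le> \<alpha>" "0 \<le> \<beta>" and "h \<noteq> []"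
  shows "\<exists>ys cf cg. length ys = r \<and>
    cf = cum_loss (fun_loss f) h ys \<and> cg = cum_loss (fun_loss g) h ys \<and>
    walk_potential \<alpha> \<beta> r (f (last h) \<noteq> g (last h)) s
      \<le> cum_loss q h ys - (cf + cg) / 2 + (\<alpha> * (s + cf - cg)\<^sup>2 - \<beta> * (s + cf - cg) ^ 4)"
  using \<open>h \<noteq> []\<close>
proof (induction r arbitrary: h s)
  case 0
  have "walk_potential \<alpha> \<beta> 0 d s \<le> \<alpha> * s\<^sup>2 - \<beta> * s ^ 4" for d
    using nonneg by (simp add: walk_potential_def algebra_simps)
  then show ?case
    by simp
next
  case (Suc r)
  define x where "x = last h"
  have step: ?case
    if "walk_potential \<alpha> \<beta> (Suc r) (f x \<noteq> g x) s \<le> q h u -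
        (of_bool (f x \<noteq> u) + of_bool (g x \<noteq> u)) / 2 +
        walk_potential \<alpha> \<beta> r (f u \<noteq> g u) (s + of_bool (f x \<noteq> u) - of_bool (g x \<noteq> u))" for u
  proof -
    define ef eg :: real where e: "ef = of_bool (f x \<noteq> u)" "eg = of_bool (g x \<noteq> u)"
    obtain ys cf cg where ys: "length ys = r"
      "cf = cum_loss (fun_loss f) (h @ [u]) ys" "cg = cum_loss (fun_loss g) (h @ [u]) ys" and
      le: "walk_potential \<alpha> \<beta> r (f u \<noteq> g u) (s + ef - eg) \<le> cum_loss q (h @ [u]) ys - (cf + cg) / 2 +
        (\<alpha> * (s + ef - eg + cf - cg)\<^sup>2 - \<beta> * (s + ef - eg + cf - cg) ^ 4)"
      using Suc.IH[of "h @ [u]" "s + ef - eg"] by auto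
    have eq: "s + ef - eg + cf - cg = s + (ef + cf) - (eg + cg)"
      by simp
    have "walk_potential \<alpha> \<beta> (Suc r) (f x \<noteq> g x) s \<le>
        (q h u + cum_loss q (h @ [u]) ys) - ((ef + cf) + (eg + cg)) / 2 +
        (\<alpha> * (s + (ef + cf) - (eg + cg))\<^sup>2 - \<beta> * (s + (ef + cf) - (eg + cg)) ^ 4)"
      using that le unfolding eq e[symmetric] by (simp add: add_divide_distrib)
    then show ?thesis
      using ys by (intro exI[of _ "u # ys"] exI[of _ "ef + cf"] exI[of _ "eg + cg"])
        (simp add: x_def[symmetric] e)
  qed
  show ?case
  proof (cases "f x = g x")
    case False
    have "2 * walk_potential \<alpha> \<beta> (Suc r) True s \<le>
        (q h (f x) - 1 / 2 + walk_potential \<alpha> \<beta> r (f (f x) \<noteq> g (f x)) (s - 1)) +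
        (q h (g x) - 1 / 2 + walk_potential \<alpha> \<beta> r (f (g x) \<noteq> g (g x)) (s + 1))"
      using walk_potential_differ[OF nonneg, of r s "f (f x) \<noteq> g (f x)" "f (g x) \<noteq> g (g x)"]
        pair_ge[OF False, of h] by linarith
    \<comment> \<open>Moving to \<open>f x\<close> is an error of \<open>g\<close> alone, hence
      \<open>s - 1\<close>; moving to \<open>g x\<close> is an error of \<open>f\<close>
      alone.\<close>
    then have "walk_potential \<alpha> \<beta> (Suc r) True s \<le>
          q h (f x) - 1 / 2 + walk_potential \<alpha> \<beta> r (f (f x) \<noteq> g (f x)) (s - 1) \<or>
        walk_potential \<alpha> \<beta> (Suc r) True s \<le>
          q h (g x) - 1 / 2 + walk_potential \<alpha> \<beta> r (f (g x) \<noteq> g (g x)) (s + 1)"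
      by linarith
    then show ?thesis
      using step[of "f x"] step[of "g x"] False by auto
  next
    case same: True
    show ?thesis
    proof (cases "f x = a")
      case True
      have "walk_potential \<alpha> \<beta> (Suc r) False s \<le> q h a + walk_potential \<alpha> \<beta> r True s"
        using walk_potential_return[OF nonneg, of r s] loss_ge[of h a] by linarith
      then show ?thesis
        using step[of a] same True fg by simp
    next
      case False
      have "2 * walk_potential \<alpha> \<beta> (Suc r) False s \<le>
          (q h (f x) + walk_potential \<alpha> \<beta> r (f (f x) \<noteq> g (f x)) s) +
          (q h a - 1 + walk_potential \<alpha> \<beta> r True s)"
        using walk_potential_same[OF nonneg, of r s "f (f x) \<noteq> g (f x)"]
          pair_ge[OF False, of h] by linarith
      then have "walk_potential \<alpha> \<beta> (Suc r) False s \<le>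
            q h (f x) + walk_potential \<alpha> \<beta> r (f (f x) \<noteq> g (f x)) s \<or>
          walk_potential \<alpha> \<beta> (Suc r) False s \<le> q h a - 1 + walk_potential \<alpha> \<beta> r True s"
        by linarith
      then show ?thesis
        using step[of "f x"] step[of a] same False fg by auto
    qed
  qed
qed

lemma regret_ge_sqrt:
  fixes f g :: "'a \<Rightarrow> 'a"
  assumes fg: "f \<noteq> g" and T: "0 < T"
  shows "\<exists>a ys. length ys = T \<and> (\<exists>k\<in>{f, g}.
    sqrt (real T) / (16 * sqrt 3) \<le> cum_loss q [a] ys - cum_loss (fun_loss k) [a] ys)"
proof -
  obtain a where a: "f a \<noteq> g a"
    using fg by auto
  define R where "R = sqrt (real T)"
  have R: "0 < R" "real T = R\<^sup>2"
    using T by (simp_all add: R_def)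
  \<comment> \<open>Chosen so that the quartic touches half the absolute value at
    \<open>\<bar>S\<bar> = 3 * R\<close>, the double root below. The potential at the start is then
    R/12 - R/36 = R/18.\<close>
  define \<alpha> \<beta> where "\<alpha> = 1 / (4 * R)" and "\<beta> = 1 / (108 * R ^ 3)"
  have nonneg: "0 \<le> \<alpha>" "0 \<le> \<beta>"
    using R by (simp_all add: \<alpha>_def \<beta>_def)
  obtain ys cf cg where ys: "length ys = T"
      "cf = cum_loss (fun_loss f) [a] ys" "cg = cum_loss (fun_loss g) [a] ys" and
    le: "walk_potential \<alpha> \<beta> T True 0
      \<le> cum_loss q [a] ys - (cf + cg) / 2 + (\<alpha> * (cf - cg)\<^sup>2 - \<beta> * (cf - cg) ^ 4)"
    using walk_value[where f = f and g = g and h = "[a]" and r = T and s = 0, OF a nonneg] a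
    by auto
  have "walk_potential \<alpha> \<beta> T True 0 = R / 18"
  proof -
    have "\<alpha> * R\<^sup>2 = R / 4" "\<beta> * (R\<^sup>2)\<^sup>2 = R / 108"
      using R(1) by (simp_all add: \<alpha>_def \<beta>_def power2_eq_square power3_eq_cube)
    then show ?thesis
      unfolding walk_potential_def R(2) by (simp add: algebra_simps)
  qed
  moreover have "\<alpha> * S\<^sup>2 - \<beta> * S ^ 4 \<le> \<bar>S\<bar> / 2" for S
  proof -
    define u where "u = \<bar>S\<bar> / R"
    have u: "0 \<le> u" "\<bar>S\<bar> = u * R"
      using R by (simp_all add: u_def)
    have "S\<^sup>2 = (u * R)\<^sup>2" "S ^ 4 = (u * R) ^ 4"
      unfolding u(2)[symmetric] by simp_all
    then have S: "\<alpha> * S\<^sup>2 = R * u\<^sup>2 / 4" "\<beta> * S ^ 4 = R * u ^ 4 / 108"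
      using R(1) by (simp_all add: \<alpha>_def \<beta>_def power_mult_distrib power2_eq_square
          power3_eq_cube power4_eq_xxxx)
    have "\<bar>S\<bar> / 2 - (\<alpha> * S\<^sup>2 - \<beta> * S ^ 4) = R / 108 * (u * ((u - 3)\<^sup>2 * (u + 6)))"
      unfolding S u(2) by (simp add: algebra_simps power2_eq_square power4_eq_xxxx)
    also have "0 \<le> \<dots>"
      using u(1) R(1) by simp
    finally show ?thesis
      by simp
  qed
  \<comment> \<open>The smaller of two numbers is their average minus half their distance.\<close>
  from this[of "cf - cg"] have "\<alpha> * (cf - cg)\<^sup>2 - \<beta> * (cf - cg) ^ 4 \<le> (cf + cg) / 2 - min cf cg"
    by (simp add: min_def abs_if field_simps split: if_splits)
  ultimately have "R / 18 \<le> cum_loss q [a] ys - min cf cg"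
    using le by linarith
  moreover have "R / (16 * sqrt 3) \<le> R / 18"
  proof (rule divide_left_mono)
    show "18 \<le> 16 * sqrt 3"
      using real_le_rsqrt[of "18 / 16" 3] by (simp add: power2_eq_square)
  qed (use R in auto)
  ultimately have "\<exists>k\<in>{f, g}. R / (16 * sqrt 3) \<le>
      cum_loss q [a] ys - cum_loss (fun_loss k) [a] ys"
    by (auto simp: ys min_def split: if_splits)
  then show ?thesis
    using ys(1) by (auto simp: R_def)
qed

end

section \<open>From abstract losses to the minimax regret\<close>

lemma minimax_regret_ge:
  fixes F :: "('a \<Rightarrow> 'a) set"
  assumes "\<And>q :: 'a list \<Rightarrow> 'a \<Rightarrow> real. guess_loss q \<Longrightarrow> \<exists>a ys. length ys = T \<and>
    (\<exists>f\<in>F. c \<le> cum_loss q [a] ys - cum_loss (fun_loss f) [a] ys)"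
  shows "ereal c \<le> minimax_regret T F"
  unfolding minimax_regret_def
proof (rule INF_greatest)
  fix M :: "('a list \<Rightarrow> 'a) measure" assume M: "M \<in> learners"
  obtain a ys f where ys: "length ys = T" and f: "f \<in> F"
      "c \<le> cum_loss (pred_loss M) [a] ys - cum_loss (fun_loss f) [a] ys"
    using assms[OF guess_loss_pred_loss[OF M]] by blast
  let ?x = "(!) (a # ys)"
  have "c \<le> expected_mistakes M T ?x - mistakes f T ?x"
    using f(2) unfolding expected_mistakes_eq[OF M] cum_loss_path[OF ys] mistakes_path[OF ys] .
  then have "ereal c \<le> ereal (expected_mistakes M T ?x) - ereal (mistakes f T ?x)"
    by simp
  also have "\<dots> \<le> ereal (expected_mistakes M T ?x) - (INF f\<in>F. ereal (mistakes f T ?x))"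
    using f(1) by (intro ereal_minus_mono INF_lower) auto
  also have "\<dots> \<le> markov_regret M T F"
    unfolding markov_regret_def by (rule SUP_upper) simp
  finally show "ereal c \<le> markov_regret M T F" .
qed

section \<open>Experts built from the standard optimal algorithm\<close>

text \<open>Arbitrary if no label keeps the full dimension; then every label lowers it.\<close>

definition soa :: "('a \<Rightarrow> 'b) set \<Rightarrow> 'a \<Rightarrow> 'b" where
  "soa F x = (SOME y. \<forall>k. shatters F k \<longrightarrow> shatters (restrict_fns F x y) k)"

text \<open>If the true label kept every shattered depth, so would the predicted one by its choice.
  Two different labels that keep depth k give depth k + 1, and all depths would be
  shattered.\<close>

lemma soa_mistake:
  assumes "f \<in> F" "\<not> shatters F d" "f x \<noteq> soa F x"
  shows "\<exists>k. shatters F k \<and> \<not> shatters (restrict_fns F x (f x)) k"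
proof (rule ccontr)
  assume "\<not> ?thesis"
  then have full: "\<forall>k. shatters F k \<longrightarrow> shatters (restrict_fns F x (f x)) k"
    by blast
  then have "\<forall>k. shatters F k \<longrightarrow> shatters (restrict_fns F x (soa F x)) k"
    unfolding soa_def by (rule someI)
  with full assms(3) have "shatters F k \<Longrightarrow> shatters F (Suc k)" for k
    unfolding shatters.simps(2) by blast
  moreover have "shatters F 0"
    using assms(1) by auto
  ultimately have "shatters F k" for k
    by (induction k) blast+
  with assms(2) show False
    by blast
qed

definition version_space :: "('a \<Rightarrow> 'a) set \<Rightarrow> nat set \<Rightarrow> (nat \<Rightarrow> 'a) \<Rightarrow> nat \<Rightarrow> ('a \<Rightarrow> 'a) set" where
  "version_space F S x t = {f \<in> F. \<forall>s\<in>S. s < t \<longrightarrow> f (x (s - 1)) = x s}"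

text \<open>\<open>length h\<close> is the time of the next prediction, and only update times before
  it count, so the rule is computable from the history.\<close>

definition expert :: "('a \<Rightarrow> 'a) set \<Rightarrow> nat set \<Rightarrow> 'a list \<Rightarrow> 'a" where
  "expert F S h = soa (version_space F S ((!) h) (length h)) (last h)"

lemma expert_path:
  assumes "0 < t"
  shows "expert F S (map x [0..<t]) = soa (version_space F S x t) (x (t - 1))"
proof -
  have "version_space F S ((!) (map x [0..<t])) t = version_space F S x t"
    unfolding version_space_def by (intro Collect_cong conj_cong refl ball_cong imp_cong) auto
  then show ?thesis
    using assms by (simp add: expert_def last_map)
qed

text \<open>Updating at exactly those times where the comparator is right and the SOA is wrong, every update
  lowers the dimension.\<close>

lemma ex_update_times:
  assumes f: "f \<in> F" and L: "\<not> shatters F (Suc L)"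
  shows "\<exists>S\<subseteq>{1..n}. f \<in> version_space F S x (Suc n) \<and> card S \<le> L \<and>
    \<not> shatters (version_space F S x (Suc n)) (Suc (L - card S)) \<and>
    (\<forall>t\<in>{1..n} - S. f (x (t - 1)) = x t \<longrightarrow> soa (version_space F S x t) (x (t - 1)) = x t)"
proof (induction n)
  case 0
  then show ?case
    using assms by (intro exI[of _ "{}"]) (simp add: version_space_def)
next
  case (Suc n)
  then obtain S where S: "S \<subseteq> {1..n}" "f \<in> version_space F S x (Suc n)" "card S \<le> L"
    and dim: "\<not> shatters (version_space F S x (Suc n)) (Suc (L - card S))"
    and right: "\<And>t. t \<in> {1..n} - S \<Longrightarrow> f (x (t - 1)) = x t \<Longrightarrow>
      soa (version_space F S x t) (x (t - 1)) = x t"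
    by blast
  define V where "V = version_space F S x (Suc n)"
  \<comment> \<open>Time n + 1 is not in \<open>S\<close>, so without an update the class stays the
    same.\<close>
  have V: "version_space F S x (Suc (Suc n)) = V"
  proof -
    have "s < Suc (Suc n) \<longleftrightarrow> s < Suc n" if "s \<in> S" for s
      using S(1) that by auto
    then show ?thesis
      unfolding V_def version_space_def by (intro Collect_cong conj_cong ball_cong refl) simp
  qed
  show ?case
  proof (cases "f (x n) = x (Suc n) \<and> soa V (x n) \<noteq> x (Suc n)")
    case False
    have "soa (version_space F S x t) (x (t - 1)) = x t"
      if "t \<in> {1..Suc n} - S" "f (x (t - 1)) = x t" for t
      using that right False by (cases "t = Suc n") (auto simp: V_def)
    moreover have "S \<subseteq> {1..Suc n}"
      using S(1) by auto
    ultimately show ?thesis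
      using S(2,3) dim unfolding V_def[symmetric] V[symmetric] by blast
  next
    case True
    define S' where "S' = insert (Suc n) S"
    have fin: "finite S" "Suc n \<notin> S"
      using S(1) by (auto intro: finite_subset)
    have V': "version_space F S' x (Suc (Suc n)) = restrict_fns V (x n) (f (x n))"
      using True unfolding V[symmetric] version_space_def S'_def by auto
    have "f (x n) \<noteq> soa V (x n)"
      using True by auto
    from soa_mistake[OF S(2)[folded V_def] dim[folded V_def] this]
    obtain k where k: "shatters V k" "\<not> shatters (restrict_fns V (x n) (f (x n))) k"
      by blast
    have "\<not> Suc (L - card S) \<le> k"
      using shatters_antimono[OF k(1)] dim[folded V_def] by blast
    then have "k \<le> L - card S"
      by simp
    then have dim': "\<not> shatters (restrict_fns V (x n) (f (x n))) (L - card S)"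
      using shatters_antimono k(2) by blast
    have f': "f \<in> restrict_fns V (x n) (f (x n))"
      using S(2) by (simp add: V_def)
    \<comment> \<open>The comparator itself survives the update, so depth 0 remains shattered. This
      is what limits the number of updates to \<open>L\<close>.\<close>
    have "L - card S \<noteq> 0"
    proof
      assume "L - card S = 0"
      then have "restrict_fns V (x n) (f (x n)) = {}"
        using dim' by simp
      with f' show False
        by blast
    qed
    then have card: "card S' \<le> L" "Suc (L - card S') = L - card S"
      using fin by (simp_all add: S'_def)
    have "version_space F S' x t = version_space F S x t" if "t \<le> Suc n" for t
      using that unfolding version_space_def S'_def by auto
    then have "soa (version_space F S' x t) (x (t - 1)) = x t"
      if "t \<in> {1..Suc n} - S'" "f (x (t - 1)) = x t" for t
      using that right by (auto simp: S'_def)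
    moreover have "S' \<subseteq> {1..Suc n}"
      using S(1) by (auto simp: S'_def)
    ultimately show ?thesis
      using card dim' f' unfolding V'[symmetric] card(2)[symmetric] by blast
  qed
qed

text \<open>The expert errs only where the comparator errs or at one of its at most \<open>L\<close>
  update times.\<close>

lemma ex_good_expert:
  assumes f: "f \<in> F" and L: "\<not> shatters F (Suc L)"
  shows "\<exists>S\<in>{S. S \<subseteq> {1..T} \<and> card S \<le> L}.
    (\<Sum>t = 1..T. of_bool (expert F S (map x [0..<t]) \<noteq> x t)) \<le> mistakes f T x + real L"
proof -
  obtain S where S: "S \<subseteq> {1..T}" "card S \<le> L"
    and right: "\<And>t. t \<in> {1..T} - S \<Longrightarrow> f (x (t - 1)) = x t \<Longrightarrow>
      soa (version_space F S x t) (x (t - 1)) = x t"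
    using ex_update_times[OF assms, of T x] by blast
  have "(\<Sum>t = 1..T. of_bool (expert F S (map x [0..<t]) \<noteq> x t) :: real) \<le>
      (\<Sum>t = 1..T. of_bool (f (x (t - 1)) \<noteq> x t) + of_bool (t \<in> S))"
    using right by (intro sum_mono) (auto simp: expert_path)
  also have "\<dots> = mistakes f T x + real (card ({1..T} \<inter> S))"
    by (simp add: sum.distrib mistakes_def Int_def of_bool_def sum.If_cases)
  also have "\<dots> \<le> mistakes f T x + real L"
    using S by (simp add: Int_absorb1)
  finally show ?thesis
    using S by blast
qed

text \<open>A set is listed as a word of length \<open>L\<close> over \<open>{0..T}\<close>, padded
  with the letter 0, which is no time.\<close>

lemma card_small_subsets: "card {S. S \<subseteq> {1..T} \<and> card S \<le> L} \<le> (T + 1) ^ L"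
proof -
  have "{S. S \<subseteq> {1..T} \<and> card S \<le> L} \<subseteq>
      (\<lambda>xs. set xs - {0}) ` {xs. set xs \<subseteq> {0..T} \<and> length xs = L}"
  proof
    fix S assume "S \<in> {S. S \<subseteq> {1..T} \<and> card S \<le> L}"
    then have S: "S \<subseteq> {1..T}" "card S \<le> L"
      by auto
    then obtain xs where xs: "set xs = S" "length xs = card S"
      by (metis finite_atLeastAtMost finite_distinct_list distinct_card finite_subset)
    show "S \<in> (\<lambda>xs. set xs - {0}) ` {xs. set xs \<subseteq> {0..T} \<and> length xs = L}"
      by (rule image_eqI[of _ _ "xs @ replicate (L - card S) 0"]) (use S xs in auto)
  qed
  then have "card {S. S \<subseteq> {1..T} \<and> card S \<le> L} \<le>
      card ((\<lambda>xs. set xs - {0}) ` {xs. set xs \<subseteq> {0..T} \<and> length xs = L})"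
    by (intro card_mono finite_imageI finite_lists_length_eq) auto
  also have "\<dots> \<le> card {xs. set xs \<subseteq> {0..T} \<and> length xs = L}"
    by (intro card_image_le finite_lists_length_eq) auto
  also have "\<dots> = (T + 1) ^ L"
    by (subst card_lists_length_eq) auto
  finally show ?thesis .
qed

section \<open>Exponential weights\<close>

text \<open>The law of the advice of an expert drawn in proportion to its weight. Its support is
  finite whatever the size of the state space.\<close>

lemma weighted_pmf:
  assumes I: "finite I" "0 < (\<Sum>i\<in>I. w i)" and w: "\<And>i. i \<in> I \<Longrightarrow> 0 \<le> w i"
  shows "\<exists>p. \<forall>y. pmf p y = (\<Sum>i\<in>I. w i * of_bool (e i = y)) / (\<Sum>i\<in>I. w i)"
proof -
  define W where "W = (\<Sum>i\<in>I. w i)"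
  define p where "p y = (\<Sum>i\<in>I. w i * of_bool (e i = y)) / W" for y
  have W: "0 < W"
    using I by (simp add: W_def)
  have nn: "0 \<le> p y" for y
    using W w by (auto simp: p_def intro!: divide_nonneg_pos sum_nonneg)
  have "p y = 0" if "y \<notin> e ` I" for y
  proof -
    have "(\<Sum>i\<in>I. w i * of_bool (e i = y)) = 0"
      using that by (intro sum.neutral) auto
    then show ?thesis
      by (simp add: p_def)
  qed
  then have "(\<integral>\<^sup>+y. ennreal (p y) \<partial>count_space UNIV) = (\<Sum>y\<in>e ` I. ennreal (p y))"
    using I by (intro nn_integral_count_space') auto
  also have "\<dots> = ennreal (\<Sum>y\<in>e ` I. p y)"
    using nn by (intro sum_ennreal) auto
  also have "(\<Sum>y\<in>e ` I. p y) = (\<Sum>i\<in>I. \<Sum>y\<in>e ` I. w i * of_bool (e i = y)) / W"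
    unfolding p_def sum_divide_distrib[symmetric] by (subst sum.swap) (rule refl)
  also have "(\<Sum>i\<in>I. \<Sum>y\<in>e ` I. w i * of_bool (e i = y)) = W"
    unfolding W_def using I(1)
    by (intro sum.cong refl) (simp add: sum_distrib_left[symmetric] of_bool_def)
  finally have "(\<integral>\<^sup>+y. ennreal (p y) \<partial>count_space UNIV) = 1"
    using W by simp
  from pmf_embed_pmf[OF nn this] show ?thesis
    unfolding p_def W_def by blast
qed

text \<open>Hoeffding's lemma for a Bernoulli loss of mean q, obtained from the gain of mean 1 - q
  by the factor \<open>exp (- \<eta>)\<close>.\<close>

lemma hedge_step:
  fixes \<eta> q :: real
  assumes "0 \<le> \<eta>" "q \<le> 1"
  shows "1 - q + q * exp (- \<eta>) \<le> exp (- \<eta> * q + \<eta>\<^sup>2 / 8)"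
proof -
  have pos: "0 < 1 + (1 - q) * (exp \<eta> - 1)"
    using assms by (intro add_pos_nonneg mult_nonneg_nonneg) auto
  have "ln (1 + (1 - q) * (exp \<eta> - 1)) \<le> \<eta> * (1 - q) + \<eta>\<^sup>2 / 8"
    using Hoeffdings_lemma_aux[of \<eta> "1 - q"] assms by simp
  then have "1 + (1 - q) * (exp \<eta> - 1) \<le> exp (\<eta> * (1 - q) + \<eta>\<^sup>2 / 8)"
    using pos by (metis exp_le_cancel_iff exp_ln)
  then have "exp (- \<eta>) * (1 + (1 - q) * (exp \<eta> - 1)) \<le>
      exp (- \<eta>) * exp (\<eta> * (1 - q) + \<eta>\<^sup>2 / 8)"
    by simp
  also have "\<dots> = exp (- \<eta> * q + \<eta>\<^sup>2 / 8)"
    by (simp add: exp_add[symmetric] algebra_simps)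
  also have "exp (- \<eta>) * (1 + (1 - q) * (exp \<eta> - 1)) = 1 - q + q * exp (- \<eta>)"
    by (simp add: algebra_simps exp_minus)
  finally show ?thesis .
qed

text \<open>The total weight shrinks with the learner's loss in every round, yet never falls below
  the weight of any single expert.\<close>

lemma hedge:
  fixes E :: "'i \<Rightarrow> 'a list \<Rightarrow> 'a"
  assumes I: "finite I" "I \<noteq> {}" and \<eta>: "0 < \<eta>"
  shows "\<exists>p :: 'a list \<Rightarrow> 'a pmf. \<forall>T x. \<forall>i\<in>I.
    (\<Sum>t = 1..T. 1 - pmf (p (map x [0..<t])) (x t)) \<le>
      (\<Sum>t = 1..T. of_bool (E i (map x [0..<t]) \<noteq> x t)) + ln (real (card I)) / \<eta> + \<eta> * real T / 8"
proof -
  define w where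
    "w h i = exp (- \<eta> * (\<Sum>s\<in>{1..<length h}. of_bool (E i (take s h) \<noteq> h ! s)))" for h i
  have wpos: "0 < (\<Sum>i\<in>I. w h i)" for h
    using I by (intro sum_pos) (auto simp: w_def)
  have "\<forall>h. \<exists>p. \<forall>y. pmf p y = (\<Sum>i\<in>I. w h i * of_bool (E i h = y)) / (\<Sum>i\<in>I. w h i)"
    by (intro allI weighted_pmf I wpos) (simp add: w_def)
  then obtain p where p: "\<And>h y. pmf (p h) y =
      (\<Sum>i\<in>I. w h i * of_bool (E i h = y)) / (\<Sum>i\<in>I. w h i)"
    by metis
  have "(\<Sum>t = 1..T. 1 - pmf (p (map x [0..<t])) (x t)) \<le>
      (\<Sum>t = 1..T. of_bool (E i (map x [0..<t]) \<noteq> x t)) + ln (real (card I)) / \<eta> + \<eta> * real T / 8"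
    if i: "i \<in> I" for T x i
  proof -
    define err :: "'i \<Rightarrow> nat \<Rightarrow> real" where "err i t = of_bool (E i (map x [0..<t]) \<noteq> x t)" for i t
    define v where "v t i = exp (- \<eta> * (\<Sum>s\<in>{1..<t}. err i s))" for t i
    define W where "W t = (\<Sum>i\<in>I. v t i)" for t
    define q where "q t = 1 - pmf (p (map x [0..<t])) (x t)" for t
    have wv: "w (map x [0..<t]) i = v t i" for t i
      unfolding w_def v_def err_def by (simp add: take_map)
    have Wpos: "0 < W t" for t
      using wpos[of "map x [0..<t]"] by (simp add: wv W_def)
    \<comment> \<open>The learner's error probability is the weighted average of the experts'
      errors.\<close>
    have q: "q t * W t = (\<Sum>i\<in>I. v t i * err i t)" for t
    proof -
      have "q t * W t = W t - (\<Sum>i\<in>I. v t i * of_bool (E i (map x [0..<t]) = x t))"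
        using Wpos[of t] unfolding q_def p wv W_def[symmetric] by (simp add: field_simps)
      also have "\<dots> = (\<Sum>i\<in>I. v t i * err i t)"
        unfolding W_def sum_subtractf[symmetric] by (intro sum.cong) (auto simp: err_def)
      finally show ?thesis .
    qed
    have step: "W (Suc t) \<le> W t * exp (- \<eta> * q t + \<eta>\<^sup>2 / 8)" if "0 < t" for t
    proof -
      have "v (Suc t) i = v t i + (exp (- \<eta>) - 1) * (v t i * err i t)" for i
      proof -
        have "{1..<Suc t} = insert t {1..<t}"
          using that by auto
        then have "v (Suc t) i = v t i * exp (- \<eta> * err i t)"
          by (simp add: v_def exp_add[symmetric] algebra_simps)
        then show ?thesis
          by (simp add: err_def algebra_simps)
      qed
      then have "W (Suc t) = (\<Sum>i\<in>I. v t i + (exp (- \<eta>) - 1) * (v t i * err i t))"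
        unfolding W_def by (intro sum.cong refl)
      also have "\<dots> = W t + (exp (- \<eta>) - 1) * (q t * W t)"
        unfolding sum.distrib sum_distrib_left[symmetric] q[symmetric] by (simp add: W_def)
      also have "\<dots> = W t * (1 - q t + q t * exp (- \<eta>))"
        by (simp add: algebra_simps)
      also have "\<dots> \<le> W t * exp (- \<eta> * q t + \<eta>\<^sup>2 / 8)"
        using \<eta> Wpos[of t] hedge_step[of \<eta> "q t"] by (intro mult_left_mono) (auto simp: q_def)
      finally show ?thesis .
    qed
    have "W (Suc n) \<le> real (card I) * exp (- \<eta> * (\<Sum>t = 1..n. q t) + \<eta>\<^sup>2 * real n / 8)" for n
    proof (induction n)
      case 0
      then show ?case
        by (simp add: W_def v_def)
    next
      case (Suc n)
      have "W (Suc (Suc n)) \<le> W (Suc n) * exp (- \<eta> * q (Suc n) + \<eta>\<^sup>2 / 8)"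
        by (rule step) simp
      also have "\<dots> \<le> (real (card I) * exp (- \<eta> * (\<Sum>t = 1..n. q t) + \<eta>\<^sup>2 * real n / 8)) *
          exp (- \<eta> * q (Suc n) + \<eta>\<^sup>2 / 8)"
        by (intro mult_right_mono Suc.IH) simp
      also have "\<dots> = real (card I) *
          exp (- \<eta> * (\<Sum>t = 1..Suc n. q t) + \<eta>\<^sup>2 * real (Suc n) / 8)"
        by (simp add: mult.assoc exp_add[symmetric] algebra_simps add_divide_distrib)
      finally show ?case .
    qed
    moreover have "exp (- \<eta> * (\<Sum>t = 1..T. err i t)) \<le> W (Suc T)"
    proof -
      have "v (Suc T) i \<le> W (Suc T)"
        unfolding W_def using I(1) i by (intro member_le_sum) (auto simp: v_def)
      then show ?thesis
        by (simp add: v_def atLeastLessThanSuc_atLeastAtMost)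
    qed
    ultimately have "exp (- \<eta> * (\<Sum>t = 1..T. err i t)) \<le>
        real (card I) * exp (- \<eta> * (\<Sum>t = 1..T. q t) + \<eta>\<^sup>2 * real T / 8)"
      by (rule order_trans[rotated])
    also have "\<dots> = exp (ln (real (card I)) + (- \<eta> * (\<Sum>t = 1..T. q t) + \<eta>\<^sup>2 * real T / 8))"
      unfolding exp_add[of "ln _"] using I by (simp add: card_gt_0_iff)
    finally have "\<eta> * (\<Sum>t = 1..T. q t) \<le>
        \<eta> * (\<Sum>t = 1..T. err i t) + ln (real (card I)) + \<eta>\<^sup>2 * real T / 8"
      unfolding exp_le_cancel_iff by linarith
    then show ?thesis
      using \<eta> unfolding q_def[symmetric] err_def[symmetric]
      by (simp add: field_simps power2_eq_square)
  qed
  then show ?thesis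
    by blast
qed

section \<open>The upper bound\<close>

text \<open>Only the law of the prediction after each single history matters, so predictions after different
  histories may be taken independent.\<close>

lemma ex_learner:
  fixes p :: "'a list \<Rightarrow> 'a pmf"
  shows "\<exists>M\<in>learners. \<forall>h y. pred_loss M h y = 1 - pmf (p h) y"
proof -
  interpret product_prob_space "\<lambda>h. measure_pmf (p h)" UNIV
    by unfold_locales
  let ?M = "\<Pi>\<^sub>M h\<in>UNIV. measure_pmf (p h)"
  have sp: "space ?M = UNIV"
    by (simp add: space_PiM)
  have meas: "(\<lambda>A. A h) \<in> measurable ?M (measure_pmf (p h))" for h
    by (rule measurable_component_singleton) simp
  have vim: "{A. A h = y} = (\<lambda>A. A h) -` {y} \<inter> space ?M" for h y
    using sp by auto
  have ev: "{A. A h = y} \<in> sets ?M" for h y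
    unfolding vim by (rule measurable_sets[OF meas]) simp
  have "?M \<in> learners"
    using sp ev prob_space_axioms by (auto simp: learners_def)
  moreover have "pred_loss ?M h y = 1 - pmf (p h) y" for h y
  proof -
    have "measure ?M {A. A h = y} = measure (distr ?M (measure_pmf (p h)) (\<lambda>A. A h)) {y}"
      unfolding vim by (rule measure_distr[OF meas, symmetric]) simp
    also have "\<dots> = pmf (p h) y"
      by (subst PiM_component) (simp_all add: pmf.rep_eq)
    finally show ?thesis
      by (simp add: pred_loss_def)
  qed
  ultimately show ?thesis
    by blast
qed

lemma minimax_regret_le:
  fixes p :: "'a list \<Rightarrow> 'a pmf"
  assumes "F \<noteq> {}" and le: "\<And>x f. f \<in> F \<Longrightarrow>
    (\<Sum>t = 1..T. 1 - pmf (p (map x [0..<t])) (x t)) \<le> mistakes f T x + c"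
  shows "minimax_regret T F \<le> ereal c"
proof -
  obtain M where M: "M \<in> learners" and p: "\<And>h y. pred_loss M h y = 1 - pmf (p h) y"
    using ex_learner by metis
  have "ereal (expected_mistakes M T x) - (INF f\<in>F. ereal (mistakes f T x)) \<le> ereal c" for x
  proof -
    have "ereal (expected_mistakes M T x - c) \<le> (INF f\<in>F. ereal (mistakes f T x))"
      using le[of _ x] by (intro INF_greatest) (force simp: expected_mistakes_eq[OF M] p)
    \<comment> \<open>The infimum must be finite before it can be moved across the extended real
      subtraction.\<close>
    moreover have "0 \<le> (INF f\<in>F. ereal (mistakes f T x))"
      by (intro INF_greatest) (simp add: mistakes_def sum_nonneg)
    moreover have "(INF f\<in>F. ereal (mistakes f T x)) \<noteq> \<infinity>"
    proof -
      obtain f where "f \<in> F"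
        using assms(1) by auto
      then have "(INF f\<in>F. ereal (mistakes f T x)) \<le> ereal (mistakes f T x)"
        by (rule INF_lower)
      then show ?thesis
        by auto
    qed
    ultimately show ?thesis
      by (cases "INF f\<in>F. ereal (mistakes f T x)") auto
  qed
  then have "markov_regret M T F \<le> ereal c"
    unfolding markov_regret_def by (rule SUP_least)
  then show ?thesis
    unfolding minimax_regret_def using M by (rule INF_lower2[rotated])
qed

lemma minimax_regret_le_horizon:
  assumes "F \<noteq> {}"
  shows "minimax_regret T F \<le> ereal (real T)"
proof (rule minimax_regret_le[OF assms, where p = "\<lambda>_. return_pmf undefined"])
  fix x :: "nat \<Rightarrow> 'a" and f :: "'a \<Rightarrow> 'a"
  have "(\<Sum>t = 1..T. 1 - pmf (return_pmf undefined) (x t)) \<le> (\<Sum>t = 1..T. 1)"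
    by (intro sum_mono) simp
  moreover have "0 \<le> mistakes f T x"
    by (simp add: mistakes_def sum_nonneg)
  ultimately show "(\<Sum>t = 1..T. 1 - pmf (return_pmf undefined) (x t)) \<le> mistakes f T x + real T"
    by simp
qed

text \<open>Two distinct functions differ at a point and so shatter depth one. Hence the class has a
  single member, and the learner follows it.\<close>

lemma minimax_regret_le_dim_0:
  assumes "F \<noteq> {}" "\<not> shatters F (Suc 0)"
  shows "minimax_regret T F \<le> 0"
proof -
  obtain f where f: "f \<in> F"
    using assms(1) by auto
  have F: "g = f" if "g \<in> F" for g
  proof (rule ccontr)
    assume "g \<noteq> f"
    then obtain x where "g x \<noteq> f x"
      by auto
    then have "shatters F (Suc 0)"
      using that f by auto
    with assms(2) show False ..
  qed
  have "minimax_regret T F \<le> ereal 0"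
  proof (rule minimax_regret_le[OF assms(1), where p = "\<lambda>h. return_pmf (f (last h))"])
    fix x :: "nat \<Rightarrow> 'a" and g assume "g \<in> F"
    then have "g = f"
      by (rule F)
    have "1 - pmf (return_pmf (f (last (map x [0..<t])))) (x t) = of_bool (f (x (t - 1)) \<noteq> x t)"
      if "t \<in> {1..T}" for t
      using that by (auto simp: last_map indicator_def)
    then have "(\<Sum>t = 1..T. 1 - pmf (return_pmf (f (last (map x [0..<t])))) (x t)) = mistakes g T x"
      unfolding mistakes_def \<open>g = f\<close> by (intro sum.cong refl)
    then show "(\<Sum>t = 1..T. 1 - pmf (return_pmf (f (last (map x [0..<t])))) (x t)) \<le>
        mistakes g T x + 0"
      by simp
  qed
  then show ?thesis
    by (simp add: zero_ereal_def)
qed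

lemma minimax_regret_le_hedge:
  fixes F :: "('a \<Rightarrow> 'a) set"
  assumes "F \<noteq> {}" "\<not> shatters F (Suc L)" "0 < L" "2 \<le> T"
  shows "minimax_regret T F \<le> ereal (real L + sqrt (real T * real L * ln (real T)))"
proof -
  define I where "I = {S. S \<subseteq> {1..T} \<and> card S \<le> L}"
  \<comment> \<open>\<open>\<Lambda>\<close> bounds the logarithm of the number of experts, since
    \<open>T + 1 \<le> T * T\<close> from \<open>T = 2\<close> on. The rate \<open>\<eta>\<close>
    makes \<open>\<Lambda> / \<eta>\<close> and \<open>\<eta> * real T / 8\<close> equal.\<close>
  define \<Lambda> where "\<Lambda> = 2 * real L * ln (real T)"
  define \<eta> where "\<eta> = sqrt (8 * \<Lambda> / real T)"
  have I: "finite I" "I \<noteq> {}"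
    by (auto simp: I_def intro!: exI[of _ "{}"])
  have \<Lambda>: "0 < \<Lambda>"
    using assms by (simp add: \<Lambda>_def)
  have \<eta>: "0 < \<eta>" "\<eta>\<^sup>2 = 8 * \<Lambda> / real T"
    using \<Lambda> assms by (simp_all add: \<eta>_def)
  have ln_card: "ln (real (card I)) \<le> \<Lambda>"
  proof -
    have "T + 1 \<le> T * 2"
      using assms by simp
    also have "\<dots> \<le> T * T"
      using assms by (intro mult_left_mono) auto
    finally have "(T + 1) ^ L \<le> (T * T) ^ L"
      by (rule power_mono) simp
    then have "card I \<le> (T * T) ^ L"
      using card_small_subsets[of T L] unfolding I_def by linarith
    then have "real (card I) \<le> real ((T * T) ^ L)"
      by (rule of_nat_mono)
    then have "ln (real (card I)) \<le> ln (real ((T * T) ^ L))"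
      using I assms by (intro ln_mono) (auto simp: card_gt_0_iff)
    also have "\<dots> = \<Lambda>"
      using assms by (simp add: \<Lambda>_def ln_realpow ln_mult)
    finally show ?thesis .
  qed
  have rate: "\<Lambda> / \<eta> + \<eta> * real T / 8 = sqrt (real T * real L * ln (real T))"
  proof (rule real_sqrt_unique[symmetric])
    have "\<Lambda> / \<eta> = \<eta> * real T / 8"
      using \<eta> assms by (simp add: field_simps power2_eq_square)
    then have "\<Lambda> / \<eta> + \<eta> * real T / 8 = \<eta> * real T / 4"
      by linarith
    then have "(\<Lambda> / \<eta> + \<eta> * real T / 8)\<^sup>2 = \<eta>\<^sup>2 * (real T)\<^sup>2 / 16"
      by (simp only:) (simp add: power_divide power_mult_distrib)
    also have "\<dots> = real T * real L * ln (real T)"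
      using assms unfolding \<eta>(2) by (simp add: \<Lambda>_def power2_eq_square)
    finally show "(\<Lambda> / \<eta> + \<eta> * real T / 8)\<^sup>2 = real T * real L * ln (real T)" .
    show "0 \<le> \<Lambda> / \<eta> + \<eta> * real T / 8"
      using \<Lambda> \<eta> by simp
  qed
  obtain p :: "'a list \<Rightarrow> 'a pmf" where p: "\<And>T x S. S \<in> I \<Longrightarrow>
      (\<Sum>t = 1..T. 1 - pmf (p (map x [0..<t])) (x t)) \<le>
        (\<Sum>t = 1..T. of_bool (expert F S (map x [0..<t]) \<noteq> x t)) +
        ln (real (card I)) / \<eta> + \<eta> * real T / 8"
    using hedge[OF I \<eta>(1), of "expert F"] by blast
  show ?thesis
  proof (rule minimax_regret_le[OF assms(1)])
    fix x f assume "f \<in> F"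
    then obtain S where S: "S \<in> I"
      "(\<Sum>t = 1..T. of_bool (expert F S (map x [0..<t]) \<noteq> x t)) \<le> mistakes f T x + real L"
      using ex_good_expert[OF _ assms(2)] unfolding I_def by blast
    have "ln (real (card I)) / \<eta> \<le> \<Lambda> / \<eta>"
      using ln_card \<eta>(1) by (simp add: divide_right_mono)
    then show "(\<Sum>t = 1..T. 1 - pmf (p (map x [0..<t])) (x t)) \<le>
        mistakes f T x + (real L + sqrt (real T * real L * ln (real T)))"
      using p[OF S(1), of x T] S(2) rate by linarith
  qed
qed

lemma minimax_regret_le_upper_bound:
  assumes "F \<noteq> {}"
  shows "minimax_regret T F \<le> upper_bound (Ldim F) T"
proof (cases "Ldim F")
  case (enat L)
  have sh: "\<not> shatters F (Suc L)"
    using shatters_imp_le_Ldim[of F "Suc L"] enat by auto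
  \<comment> \<open>Horizons below 2 fall under the first two cases, so exponential weights only
    face \<open>T \<ge> 2\<close>.\<close>
  consider "L = 0" | "T \<le> L" | "0 < L" "2 \<le> T"
    by linarith
  then have "minimax_regret T F \<le> ereal (real L + sqrt (real T * real L * ln (real T)))"
  proof cases
    case 1
    have "minimax_regret T F \<le> 0"
      by (rule minimax_regret_le_dim_0[OF assms sh[unfolded 1]])
    then show ?thesis
      using 1 by (simp add: zero_ereal_def)
  next
    case 2
    have "0 \<le> sqrt (real T * real L * ln (real T))"
      by (cases T) auto
    then have "real T \<le> real L + sqrt (real T * real L * ln (real T))"
      using 2 by linarith
    then have "ereal (real T) \<le> ereal (real L + sqrt (real T * real L * ln (real T)))"
      by simp
    then show ?thesis
      using minimax_regret_le_horizon[OF assms, of T] by (rule order_trans[rotated])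
  next
    case 3
    then show ?thesis
      by (rule minimax_regret_le_hedge[OF assms sh])
  qed
  then show ?thesis
    by (simp add: upper_bound_def enat)
qed (simp add: upper_bound_def)

text \<open>The regret is at most \<open>T\<close>, so a lower bound by the dimension must be capped
  by the horizon or assume \<open>Ldim F \<le> enat T\<close>. A class with one member has regret at
  most 0, so the bound by the root of \<open>T\<close> asks for two.\<close>

theorem theorem15:
  fixes F :: "('a \<Rightarrow> 'a) set" and T :: nat
  assumes "F \<noteq> {}"
  shows "((\<exists>f\<in>F. \<exists>g\<in>F. f \<noteq> g) \<and> Ldim F \<le> enat T \<longrightarrow>
            max (ereal_of_enat (Ldim F) / 18) (ereal (sqrt (real T) / (16 * sqrt 3)))
              \<le> minimax_regret T F) \<and>
         minimax_regret T F \<le> upper_bound (Ldim F) T \<and>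
         ereal_of_enat (min (Ldim F) (enat T)) / 18 \<le> minimax_regret T F \<and>
         ((\<exists>f\<in>F. \<exists>g\<in>F. f \<noteq> g) \<longrightarrow>
            ereal (sqrt (real T) / (16 * sqrt 3)) \<le> minimax_regret T F)"
proof -
  obtain d where d: "min (Ldim F) (enat T) = enat d"
    by (metis enat_ile min.cobounded2)
  then have "enat d \<le> Ldim F" "d \<le> T"
    by (metis min.cobounded1, metis enat_ord_simps(1) min.cobounded2)
  then have "ereal (real d / 18) \<le> minimax_regret T F"
    using le_Ldim_imp_shatters[OF assms] guess_loss.regret_ge_dim
    by (intro minimax_regret_ge) blast
  then have dim: "ereal_of_enat (min (Ldim F) (enat T)) / 18 \<le> minimax_regret T F"
    by (simp add: d)
  have root: "ereal (sqrt (real T) / (16 * sqrt 3)) \<le> minimax_regret T F"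
    if two: "\<exists>f\<in>F. \<exists>g\<in>F. f \<noteq> g"
  \<comment> \<open>The random walk needs a step; for \<open>T = 0\<close> the root vanishes and the
    capped bound is already nonnegative.\<close>
  proof (cases "T = 0")
    case True
    have "0 \<le> ereal_of_enat (min (Ldim F) (enat T)) / 18"
      by (simp add: d)
    then show ?thesis
      using dim True by (simp add: zero_ereal_def order_trans)
  next
    case False
    obtain f g where fg: "f \<in> F" "g \<in> F" "f \<noteq> g"
      using two by blast
    show ?thesis
    proof (rule minimax_regret_ge)
      fix q :: "'a list \<Rightarrow> 'a \<Rightarrow> real" assume "guess_loss q"
      then show "\<exists>a ys. length ys = T \<and> (\<exists>k\<in>F.
          sqrt (real T) / (16 * sqrt 3) \<le> cum_loss q [a] ys - cum_loss (fun_loss k) [a] ys)"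
        using guess_loss.regret_ge_sqrt[of q f g T] False fg by auto
    qed
  qed
  have "max (ereal_of_enat (Ldim F) / 18) (ereal (sqrt (real T) / (16 * sqrt 3)))
      \<le> minimax_regret T F"
    if "\<exists>f\<in>F. \<exists>g\<in>F. f \<noteq> g" "Ldim F \<le> enat T"
    using dim root[OF that(1)] that(2) by (simp add: min_absorb1)
  then show ?thesis
    using dim root minimax_regret_le_upper_bound[OF assms, of T] by (intro conjI impI) auto
qed

end
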